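(* Let $(p_0,p_1,p_3)$ be a probability vector with $p_0,p_1,p_3>0$, and let $\nu$ be the self-similar measure on $\mathbb{R}$ associated with $\{S_i(x)=\frac13x+i\}_{i\in\{0,1,3\}}$ and the weights $(p_0,p_1,p_3)$, i.e. the unique Borel probability measure with $\nu=\sum_{i\in\{0,1,3\}}p_i\,\nu\circ S_i^{-1}$. Let $$\beta(q):=\limsup_{n\to\infty}\frac{\log\sum_{C\in\mathcal{D}_n}\nu(C)^q}{\log 2^n},\qquad q>0,$$ be the $L^q$-spectrum of $\nu$, where $\mathcal{D}_n=\{(k/2^n,(k+1)/2^n]:k\in\mathbb{Z}\}$ (the sum being over those $C$ with $\nu(C)>0$). Then for every $q\in(0,1)$ $$\beta(q)=\frac{p(q)}{\log 3},$$ where $p$ is the pressure function defined in the context.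
   Context: Alphabet $\mathcal{A}=\{0,1,3\}$. For a word $\mathbf{i}=(i_1,\dots,i_n)\in\mathcal{A}^n$ write $S_{\mathbf{i}}=S_{i_1}\circ\cdots\circ S_{i_n}$ and $p_{\mathbf{i}}=p_{i_1}\cdots p_{i_n}$. $\mathcal{T}_n=\{\mathbf{i}\in\mathcal{A}^n:(i_k,i_{k+1})\neq(0,3)\ \forall k<n\}$ and $\mathcal{U}_n=\{\mathbf{i}\in\mathcal{A}^n:(i_k,i_{k+1})\neq(1,0)\ \forall k<n\}$. Put $\mathcal{W}_n=\mathcal{T}_n$ if $p_1\ge p_3$ and $\mathcal{W}_n=\mathcal{U}_n$ if $p_3>p_1$. For $\mathbf{i}\in\mathcal{W}_n$ let $\mathcal{I}_{\mathbf{i}}=\{\boldsymbol{\eta}\in\mathcal{A}^n:S_{\boldsymbol{\eta}}=S_{\mathbf{i}}\}$ and $\psi(\mathbf{i})=\sum_{\boldsymbol{\eta}\in\mathcal{I}_{\mathbf{i}}}p_{\boldsymbol{\eta}}$. For $t\ge0$, $$p(t):=\lim_{n\to\infty}\frac1n\log\sum_{\mathbf{i}\in\mathcal{W}_n}\psi(\mathbf{i})^t$$ (the limit exists). *)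

theory Defs
  imports "HOL-Analysis.Analysis" "HOL-Probability.Probability_Measure"
begin

definition alphabet :: "nat set" where
  "alphabet = {0, 1, 3}"

definition S :: "nat \<Rightarrow> real \<Rightarrow> real" where
  "S i x = x / 3 + real i"

definition words :: "nat \<Rightarrow> nat list set" where
  "words n = {w. length w = n \<and> set w \<subseteq> alphabet}"

definition S_word :: "nat list \<Rightarrow> real \<Rightarrow> real" where
  "S_word w = foldr (\<lambda>i f. S i \<circ> f) w id"

definition p_word :: "(nat \<Rightarrow> real) \<Rightarrow> nat list \<Rightarrow> real" where
  "p_word p w = (\<Prod>i\<leftarrow>w. p i)"

definition T_words :: "nat \<Rightarrow> nat list set" where
  "T_words n = {w \<in> words n. \<forall>k. Suc k < n \<longrightarrow> (w ! k, w ! Suc k) \<noteq> (0, 3)}"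

definition U_words :: "nat \<Rightarrow> nat list set" where
  "U_words n = {w \<in> words n. \<forall>k. Suc k < n \<longrightarrow> (w ! k, w ! Suc k) \<noteq> (1, 0)}"

definition W_words :: "(nat \<Rightarrow> real) \<Rightarrow> nat \<Rightarrow> nat list set" where
  "W_words p n = (if p 1 \<ge> p 3 then T_words n else U_words n)"

definition same_map_words :: "nat list \<Rightarrow> nat list set" where
  "same_map_words w = {v \<in> words (length w). S_word v = S_word w}"

definition \<psi> :: "(nat \<Rightarrow> real) \<Rightarrow> nat list \<Rightarrow> real" where
  "\<psi> p w = (\<Sum>v\<in>same_map_words w. p_word p v)"

definition pressure :: "(nat \<Rightarrow> real) \<Rightarrow> real \<Rightarrow> real" where
  "pressure p t = lim (\<lambda>n. 1 / real n * ln (\<Sum>w\<in>W_words p n. \<psi> p w powr t))"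

definition probability_vector :: "(nat \<Rightarrow> real) \<Rightarrow> bool" where
  "probability_vector p \<longleftrightarrow> (\<forall>i\<in>alphabet. p i \<ge> 0) \<and> (\<Sum>i\<in>alphabet. p i) = 1"

definition self_similar_measure :: "(nat \<Rightarrow> real) \<Rightarrow> real measure \<Rightarrow> bool" where
  "self_similar_measure p \<nu> \<longleftrightarrow>
     prob_space \<nu> \<and> sets \<nu> = sets borel \<and>
     (\<forall>B\<in>sets borel. measure \<nu> B = (\<Sum>i\<in>alphabet. p i * measure \<nu> (S i -` B)))"

definition dyadic_cells :: "nat \<Rightarrow> real set set" where
  "dyadic_cells n = {{real_of_int k / 2 ^ n <.. (real_of_int k + 1) / 2 ^ n} | k :: int. True}"

(* The sum is written as an unordered infinite sum, which is a finite sum when the measure has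
   bounded support, as self-similar measures do. For a measure with a divergent sum,
   infsum would return 0 instead of infinity. *)
definition Lq_spectrum :: "real measure \<Rightarrow> real \<Rightarrow> ereal" where
  "Lq_spectrum \<nu> q = limsup (\<lambda>n. ereal
     (ln (\<Sum>\<^sub>\<infinity>C\<in>{C \<in> dyadic_cells n. measure \<nu> C > 0}. measure \<nu> C powr q) / ln (2 ^ n)))"

end

theory Submission
  imports Defs
begin

text \<open>
  A word of length n is determined as a map by the integer N with base-3 expansion the word, since
  the map is x \<mapsto> (x + 3N)/3^n; distinct maps of one level are thus uniformly separated at scale 3^-n,
  and the words of W_n represent each of them exactly once (03 and 10 have the same value).
  Hence the pressure sums are the sums of q-th powers of the masses at these integers. As q < 1,
  t \<mapsto> t^q is subadditive, which makes the sums submultiplicative, so the limit exists by Fekete's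
  argument. The same subadditivity gives the comparison with the dyadic sums at a scale
  3^k \<le> 2^n < 3^(k+1): the measure lives on [-5, 5], a dyadic cell is charged only by the boundedly
  many integers whose piece [(3N - 5)/3^k, (3N + 5)/3^k] it meets, and conversely the mass at N is at
  most the measure of its piece, which is covered by boundedly many cells.
\<close>

section \<open>Subadditivity and counting\<close>

text \<open>Fekete's argument, the limit being the infimum \<open>L\<close> of the quotients;
  nonnegativity keeps them bounded below.\<close>

lemma subadditive_limit_exists:
  fixes f :: "nat \<Rightarrow> real"
  assumes sub: "\<And>m n. f (m + n) \<le> f m + f n" and nonneg: "\<And>n. 0 \<le> f n"
  shows "convergent (\<lambda>n. f n / real n)"
proof -
  define L where "L = (INF n\<in>{1..}. f n / real n)"
  have bdd: "bdd_below ((\<lambda>n. f n / real n) ` {1..})"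
    by (rule bdd_belowI[of _ 0]) (auto intro: nonneg divide_nonneg_nonneg)
  have lower: "L \<le> f n / real n" if "n \<ge> 1" for n
    unfolding L_def using that by (intro cINF_lower bdd) auto
  have mult: "f (k * m + r) \<le> real k * f m + f r" for k m r
  proof (induction k)
    case (Suc k)
    have "f (Suc k * m + r) \<le> f m + f (k * m + r)"
      using sub[of m "k * m + r"] by (simp add: algebra_simps)
    with Suc show ?case by (simp add: algebra_simps)
  qed simp
  have "(\<lambda>n. f n / real n) \<longlonglongrightarrow> L"
  proof (rule LIMSEQ_I)
    fix e :: real assume e: "e > 0"
    obtain m where m: "m \<ge> 1" "f m / real m < L + e / 2"
      using cInf_lessD[of "(\<lambda>n. f n / real n) ` {1..}" "L + e / 2"] e
      unfolding L_def[symmetric] by auto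
    \<comment> \<open>\<open>M\<close> bounds the remainder term \<open>f (n mod m)\<close> for all
      n at once; \<open>n0\<close> then makes it smaller than half of e n.\<close>
    define M where "M = (\<Sum>r<m. f r)"
    obtain n0 :: nat where n0: "real n0 > 2 * M / e" using reals_Archimedean2 by blast
    have "norm (f n / real n - L) < e" if n: "n \<ge> max 1 n0" for n
    proof -
      have npos: "real n > 0" using n by simp
      have "f (n mod m) \<le> M"
        unfolding M_def using m nonneg by (intro member_le_sum) auto
      moreover have "f n \<le> real (n div m) * f m + f (n mod m)"
        using mult[of "n div m" m "n mod m"] by simp
      moreover have "real (n div m) * f m \<le> real n / real m * f m"
        by (intro mult_right_mono nonneg of_nat_div_le_of_nat)
      ultimately have "f n \<le> real n * (f m / real m) + M" by (simp add: field_simps)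
      also have "\<dots> < real n * (L + e / 2) + M"
        using m npos by (intro add_strict_right_mono mult_strict_left_mono) auto
      also have "M < real n * (e / 2)"
      proof -
        have "2 * M / e < real n" using n0 n by linarith
        then show ?thesis using e by (simp add: field_simps)
      qed
      finally have "f n < real n * (L + e)" by (simp add: algebra_simps)
      then have "f n / real n < L + e" using npos by (simp add: field_simps)
      with lower[of n] n e show ?thesis by (simp add: abs_if)
    qed
    then show "\<exists>n0. \<forall>n\<ge>n0. norm (f n / real n - L) < e" by blast
  qed
  then show ?thesis by (rule convergentI)
qed

text \<open>Dividing by x + y gives two fractions in [0, 1] that add up to 1, and raising to a power
  below 1 cannot decrease them.\<close>

lemma powr_add_le:
  fixes x y q :: real
  assumes "0 \<le> x" "0 \<le> y" "0 < q" "q < 1"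
  shows "(x + y) powr q \<le> x powr q + y powr q"
proof (cases "x + y = 0")
  case False
  define s where "s = x + y"
  have s: "s > 0" using assms False by (simp add: s_def)
  have *: "z / s \<le> (z / s) powr q" if "0 \<le> z" "z \<le> s" for z
  proof (cases "z = 0")
    case False
    with that s have "(z / s) powr 1 \<le> (z / s) powr q"
      using assms by (intro powr_mono') auto
    then show ?thesis using that s by simp
  qed (use assms in simp)
  have "1 = x / s + y / s" using s by (simp add: s_def add_divide_distrib[symmetric])
  also have "\<dots> \<le> (x / s) powr q + (y / s) powr q"
    using assms by (intro add_mono *) (auto simp: s_def)
  also have "\<dots> = (x powr q + y powr q) / s powr q"
    using assms s by (simp add: powr_divide add_divide_distrib)
  finally show ?thesis using s by (simp add: s_def[symmetric] field_simps)
qed (use assms in auto)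

lemma powr_sum_le:
  fixes f :: "'a \<Rightarrow> real"
  assumes "\<And>i. i \<in> A \<Longrightarrow> 0 \<le> f i" "0 < q" "q < 1"
  shows "(\<Sum>i\<in>A. f i) powr q \<le> (\<Sum>i\<in>A. f i powr q)"
  using assms(1)
proof (induction A rule: infinite_finite_induct)
  case (insert x A)
  have "(f x + sum f A) powr q \<le> f x powr q + sum f A powr q"
    using insert assms by (intro powr_add_le sum_nonneg) auto
  also have "\<dots> \<le> f x powr q + (\<Sum>i\<in>A. f i powr q)"
    using insert by auto
  finally show ?case using insert by simp
qed (use assms in auto)

text \<open>Meant for families of intervals whose ends vary with an index while \<open>c\<close>
  does not, which gives uniform counts.\<close>

lemma card_int_le:
  fixes a b c :: real
  assumes "\<And>j. j \<in> A \<Longrightarrow> a \<le> real_of_int j \<and> real_of_int j \<le> b" "b - a \<le> c" "0 \<le> c"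
  shows "finite A" "real (card A) \<le> c + 1"
proof -
  have sub: "A \<subseteq> {\<lceil>a\<rceil>..\<lfloor>b\<rfloor>}"
    using assms(1) by (auto simp: le_floor_iff ceiling_le_iff)
  then show "finite A" by (rule finite_subset) simp
  have "card A \<le> nat (\<lfloor>b\<rfloor> - \<lceil>a\<rceil> + 1)"
    using card_mono[OF _ sub] by simp
  moreover have "real_of_int (\<lfloor>b\<rfloor> - \<lceil>a\<rceil> + 1) \<le> c + 1"
    using assms(2) by (simp, linarith)
  ultimately show "real (card A) \<le> c + 1" using assms(3) by linarith
qed

lemma sum_fibre:
  fixes f :: "'b \<Rightarrow> real"
  assumes "finite A"
  shows "(\<Sum>w\<in>A. h w * f (g w)) = (\<Sum>N\<in>g ` A. (\<Sum>w\<in>{w\<in>A. g w = N}. h w) * f N)"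
  by (subst sum.image_gen[OF assms, of _ g]) (auto intro!: sum.cong simp: sum_distrib_right)

section \<open>Words and their translation parts\<close>

text \<open>Most significant digit first, so the last letter fixes the value modulo 3. The letter 3
  has the residue of 0, which is how different words can share a value.\<close>

definition val :: "nat list \<Rightarrow> nat" where
  "val w = foldl (\<lambda>a d. 3 * a + d) 0 w"

lemma val_Nil [simp]: "val [] = 0"
  and val_snoc [simp]: "val (w @ [d]) = 3 * val w + d"
  by (simp_all add: val_def)

lemma val_append: "val (u @ v) = 3 ^ length v * val u + val v"
  by (induction v rule: rev_induct) (simp_all flip: append_assoc add: algebra_simps)

lemma S_word_Nil [simp]: "S_word [] = id"
  and S_word_Cons: "S_word (i # w) = S i \<circ> S_word w"
  by (simp_all add: S_word_def)

lemma S_word_append: "S_word (u @ v) = S_word u \<circ> S_word v"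
  by (induction u) (simp_all add: S_word_Cons comp_assoc)

text \<open>The factor 3 comes from S i x = (x + 3 i) / 3. The induction is on the last letter, in
  step with \<open>val_snoc\<close>.\<close>

lemma S_word_eq: "S_word w x = (x + 3 * real (val w)) / 3 ^ length w"
proof (induction w arbitrary: x rule: rev_induct)
  case (snoc d w)
  have "S_word (w @ [d]) x = S_word w (S d x)"
    by (simp add: S_word_append S_word_Cons)
  also have "\<dots> = (S d x + 3 * real (val w)) / 3 ^ length w"
    by (rule snoc)
  finally show ?case by (simp add: S_def field_simps)
qed simp

lemma S_word_eq_iff:
  assumes "length v = length w"
  shows "S_word v = S_word w \<longleftrightarrow> val v = val w"
proof
  assume "S_word v = S_word w"
  then have "S_word v 0 = S_word w 0" by simp
  then show "val v = val w" using assms by (simp add: S_word_eq)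
qed (use assms in \<open>auto simp: S_word_eq fun_eq_iff\<close>)

lemma p_word_append: "p_word p (u @ v) = p_word p u * p_word p v"
  by (simp add: p_word_def)

lemma words_length: "w \<in> words n \<Longrightarrow> length w = n"
  by (simp add: words_def)

lemma words_0 [simp]: "words 0 = {[]}"
  by (auto simp: words_def)

lemma finite_words [simp]: "finite (words n)"
proof -
  have "words n = {w. set w \<subseteq> alphabet \<and> length w = n}" by (auto simp: words_def)
  then show ?thesis by (simp add: finite_lists_length_eq alphabet_def)
qed

lemma words_add: "bij_betw (\<lambda>(u, v). u @ v) (words n \<times> words k) (words (n + k))"
proof (rule bij_betw_imageI)
  show "inj_on (\<lambda>(u, v). u @ v) (words n \<times> words k)"
    by (auto simp: inj_on_def words_def)
  have "w \<in> (\<lambda>(u, v). u @ v) ` (words n \<times> words k)" if "w \<in> words (n + k)" for w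
    using that set_take_subset[of n w] set_drop_subset[of n w]
    by (intro image_eqI[of _ _ "(take n w, drop n w)"]) (auto simp: words_def)
  then show "(\<lambda>(u, v). u @ v) ` (words n \<times> words k) = words (n + k)"
    by (auto simp: words_def)
qed

lemma words_snoc_iff: "w @ [d] \<in> words (Suc n) \<longleftrightarrow> w \<in> words n \<and> d \<in> alphabet"
  by (auto simp: words_def)

lemma words_SucE:
  assumes "w \<in> words (Suc n)"
  obtains u d where "w = u @ [d]" "u \<in> words n" "d \<in> alphabet"
  using assms by (cases w rule: rev_cases) (auto simp: words_def)

section \<open>Unique representation of values by words avoiding 03 or 10\<close>

definition avoids :: "nat \<times> nat \<Rightarrow> nat list \<Rightarrow> bool" where
  "avoids c w \<longleftrightarrow> (\<forall>k. Suc k < length w \<longrightarrow> (w ! k, w ! Suc k) \<noteq> c)"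

lemma T_words_iff: "w \<in> T_words n \<longleftrightarrow> w \<in> words n \<and> avoids (0, 3) w"
  and U_words_iff: "w \<in> U_words n \<longleftrightarrow> w \<in> words n \<and> avoids (1, 0) w"
  by (auto simp: T_words_def U_words_def avoids_def words_def)

lemma avoids_snoc:
  "avoids c (w @ [d]) \<longleftrightarrow> avoids c w \<and> (w = [] \<or> (last w, d) \<noteq> c)"
proof (cases w rule: rev_cases)
  case (snoc u e)
  have "avoids c ((u @ [e]) @ [d]) \<longleftrightarrow> avoids c (u @ [e]) \<and> (e, d) \<noteq> c"
    unfolding avoids_def
    by (auto simp: nth_append less_Suc_eq)
  then show ?thesis using snoc by simp
qed (simp add: avoids_def)

lemma avoids_Nil [simp]: "avoids c []"
  by (simp add: avoids_def)

text \<open>Modulo 3, equality would force u to end in 1 and v in 3, since v does not end in 0.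
  Removing these letters leaves the same equation for the prefixes, and the prefix of v again does
  not end in 0 because 03 is forbidden, so the descent reaches the empty words.\<close>

lemma T_val_neq_Suc:
  assumes "u \<in> words n" "v \<in> words n" "avoids (0, 3) v" "v = [] \<or> last v \<noteq> 0"
  shows "val u \<noteq> Suc (val v)"
  using assms
proof (induction n arbitrary: u v)
  case (Suc n)
  obtain u' d v' e where uv: "u = u' @ [d]" "u' \<in> words n" "d \<in> alphabet"
      "v = v' @ [e]" "v' \<in> words n" "e \<in> alphabet"
    using Suc.prems by (metis words_SucE)
  show ?case
  proof
    assume eq: "val u = Suc (val v)"
    have "e = 3" "d = 1"
      using uv Suc.prems(4) eq by (auto simp: alphabet_def; presburger)+
    with eq uv have "val u' = Suc (val v')" by simp
    moreover have "avoids (0, 3) v'" "v' = [] \<or> last v' \<noteq> 0"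
      using Suc.prems(3) uv \<open>e = 3\<close> by (auto simp: avoids_snoc)
    ultimately show False using Suc.IH uv by blast
  qed
qed auto

text \<open>Residues settle this without induction: if u ends in 0 or 3, then v would have value 2
  modulo 3, which no letter allows.\<close>

lemma U_val_neq_Suc:
  assumes "u \<in> words n" "v \<in> words n" "u = [] \<or> last u \<noteq> 1"
  shows "val u \<noteq> Suc (val v)"
proof (cases n)
  case (Suc m)
  obtain u' d v' e where uv: "u = u' @ [d]" "d \<in> alphabet" "v = v' @ [e]" "e \<in> alphabet"
    using assms Suc by (metis words_SucE)
  with assms(3) show ?thesis by (auto simp: alphabet_def; presburger)
qed (use assms in auto)

text \<open>Last letters that agree modulo 3 are equal or are 0 and 3. In the second case the values
  of the prefixes differ by one, which \<open>T_val_neq_Suc\<close> excludes, since the prefix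
  followed by 3 does not end in 0.\<close>

lemma inj_on_val_T: "inj_on val (T_words n)"
proof (induction n)
  case (Suc n)
  show ?case
  proof (rule inj_onI)
    fix u v assume u: "u \<in> T_words (Suc n)" and v: "v \<in> T_words (Suc n)" and eq: "val u = val v"
    obtain u' d v' e where uv: "u = u' @ [d]" "u' \<in> words n" "d \<in> alphabet"
        "v = v' @ [e]" "v' \<in> words n" "e \<in> alphabet"
      using u v by (metis words_SucE T_words_iff)
    have av: "avoids (0, 3) u'" "avoids (0, 3) v'" 
        "d = 3 \<Longrightarrow> u' = [] \<or> last u' \<noteq> 0" "e = 3 \<Longrightarrow> v' = [] \<or> last v' \<noteq> 0"
      using u v uv by (auto simp: T_words_iff avoids_snoc)
    have "d \<noteq> 0 \<or> e \<noteq> 3"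
      using T_val_neq_Suc[of u' n v'] av uv eq by auto
    moreover have "d \<noteq> 3 \<or> e \<noteq> 0"
      using T_val_neq_Suc[of v' n u'] av uv eq by auto
    ultimately have "d = e" using uv eq by (auto simp: alphabet_def; presburger)
    with eq uv have "val u' = val v'" by simp
    then have "u' = v'" using Suc uv av by (auto simp: inj_on_def T_words_iff)
    with \<open>d = e\<close> uv show "u = v" by simp
  qed
qed (auto simp: T_words_iff inj_on_def)

text \<open>As for \<open>T_words\<close>, but now the prefix followed by 0 is the restricted one:
  it does not end in 1, as \<open>U_val_neq_Suc\<close> requires.\<close>

lemma inj_on_val_U: "inj_on val (U_words n)"
proof (induction n)
  case (Suc n)
  show ?case
  proof (rule inj_onI)
    fix u v assume u: "u \<in> U_words (Suc n)" and v: "v \<in> U_words (Suc n)" and eq: "val u = val v"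
    obtain u' d v' e where uv: "u = u' @ [d]" "u' \<in> words n" "d \<in> alphabet"
        "v = v' @ [e]" "v' \<in> words n" "e \<in> alphabet"
      using u v by (metis words_SucE U_words_iff)
    have av: "avoids (1, 0) u'" "avoids (1, 0) v'" 
        "d = 0 \<Longrightarrow> u' = [] \<or> last u' \<noteq> 1" "e = 0 \<Longrightarrow> v' = [] \<or> last v' \<noteq> 1"
      using u v uv by (auto simp: U_words_iff avoids_snoc)
    have "d \<noteq> 0 \<or> e \<noteq> 3"
      using U_val_neq_Suc[of u' n v'] av uv eq by auto
    moreover have "d \<noteq> 3 \<or> e \<noteq> 0"
      using U_val_neq_Suc[of v' n u'] av uv eq by (cases "e = 0") auto
    ultimately have "d = e" using uv eq by (auto simp: alphabet_def; presburger)
    with eq uv have "val u' = val v'" by simp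
    then have "u' = v'" using Suc uv av by (auto simp: inj_on_def U_words_iff)
    with \<open>d = e\<close> uv show "u = v" by simp
  qed
qed (auto simp: U_words_iff inj_on_def)

lemma T_words_representative: "w \<in> words n \<Longrightarrow> \<exists>u\<in>T_words n. val u = val w"
proof (induction n arbitrary: w)
  case (Suc n)
  obtain w' d where w: "w = w' @ [d]" "w' \<in> words n" "d \<in> alphabet"
    using Suc.prems by (rule words_SucE)
  obtain u where u: "u \<in> T_words n" "val u = val w'" using Suc.IH w by blast
  show ?case
  proof (cases "d = 3 \<and> u \<noteq> [] \<and> last u = 0")
    case False
    then show ?thesis using u w
      by (intro bexI[of _ "u @ [d]"]) (auto simp: T_words_iff avoids_snoc words_snoc_iff)
  next
    case True
    then obtain u' where u': "u = u' @ [0]" by (metis append_butlast_last_id)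
    \<comment> \<open>Rewriting the new 03 to 10 keeps the value and cannot create another 03,
      whatever \<open>u'\<close> ends in.\<close>
    have "(u' @ [1]) @ [0] \<in> T_words (Suc n)"
      using u u' by (simp add: T_words_iff avoids_snoc[of _ u'] avoids_snoc[of _ "u' @ [Suc 0]"]
          words_def alphabet_def del: append_assoc)
    moreover have "val ((u' @ [1]) @ [0]) = val w"
      using u u' w True by (simp del: append_assoc)
    ultimately show ?thesis by blast
  qed
qed (auto simp: T_words_iff)

lemma U_words_representative: "w \<in> words n \<Longrightarrow> \<exists>u\<in>U_words n. val u = val w"
proof (induction n arbitrary: w)
  case (Suc n)
  obtain w' d where w: "w = w' @ [d]" "w' \<in> words n" "d \<in> alphabet"
    using Suc.prems by (rule words_SucE)
  obtain u where u: "u \<in> U_words n" "val u = val w'" using Suc.IH w by blast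
  show ?case
  proof (cases "d = 0 \<and> u \<noteq> [] \<and> last u = 1")
    case False
    then show ?thesis using u w
      by (intro bexI[of _ "u @ [d]"]) (auto simp: U_words_iff avoids_snoc words_snoc_iff)
  next
    case True
    then obtain u' where u': "u = u' @ [1]" by (metis append_butlast_last_id)
    \<comment> \<open>Rewriting 10 to 03 may create another 10 when \<open>u'\<close> ends in 1. As
      \<open>u' @ [0]\<close> still has length n, the induction hypothesis repairs it, and the
      appended 3 never completes a 10.\<close>
    have "u' @ [0] \<in> words n"
      using u u' by (auto simp: U_words_iff words_def alphabet_def)
    then obtain v where v: "v \<in> U_words n" "val v = 3 * val u'"
      using Suc.IH by fastforce
    have "v @ [3] \<in> U_words (Suc n)"
      using v by (auto simp: U_words_iff avoids_snoc words_snoc_iff alphabet_def)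
    moreover have "val (v @ [3]) = val w" using v u u' w True by auto
    ultimately show ?thesis by blast
  qed
qed (auto simp: U_words_iff)

text \<open>Both cases of \<open>W_words\<close> pick exactly one word per value, so sums over
  \<open>W_words p n\<close> can be indexed by values without a case distinction.\<close>

lemma bij_betw_val_W: "bij_betw val (W_words p n) (val ` words n)"
proof (rule bij_betw_imageI)
  show "inj_on val (W_words p n)"
    using inj_on_val_T inj_on_val_U by (simp add: W_words_def)
  have "W_words p n \<subseteq> words n"
    by (auto simp: W_words_def T_words_iff U_words_iff)
  moreover have "val w \<in> val ` W_words p n" if w: "w \<in> words n" for w
  proof -
    have "\<exists>u\<in>W_words p n. val u = val w"
      using T_words_representative[OF w] U_words_representative[OF w] by (simp add: W_words_def)
    then show ?thesis by (metis imageI)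
  qed
  ultimately show "val ` W_words p n = val ` words n" by blast
qed

section \<open>The pressure\<close>

text \<open>For a probability vector, this is the law of \<open>val w\<close> when the n letters of
  w are drawn independently with weights p.\<close>

definition mass :: "(nat \<Rightarrow> real) \<Rightarrow> nat \<Rightarrow> nat \<Rightarrow> real" where
  "mass p n N = (\<Sum>w\<in>{w\<in>words n. val w = N}. p_word p w)"

definition level_sum :: "(nat \<Rightarrow> real) \<Rightarrow> real \<Rightarrow> nat \<Rightarrow> real" where
  "level_sum p q n = (\<Sum>N\<in>val ` words n. mass p n N powr q)"

lemma \<psi>_eq_mass: "w \<in> words n \<Longrightarrow> \<psi> p w = mass p n (val w)"
  unfolding \<psi>_def mass_def same_map_words_def
  by (rule sum.cong) (auto simp: words_def S_word_eq_iff)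

lemma level_sum_eq: "(\<Sum>w\<in>W_words p n. \<psi> p w powr t) = level_sum p t n"
proof -
  have "(\<Sum>w\<in>W_words p n. \<psi> p w powr t) = (\<Sum>w\<in>W_words p n. mass p n (val w) powr t)"
    by (rule sum.cong)
      (auto simp: W_words_def T_words_def U_words_def \<psi>_eq_mass split: if_splits)
  also have "\<dots> = level_sum p t n"
    unfolding level_sum_def by (rule sum.reindex_bij_betw[OF bij_betw_val_W])
  finally show ?thesis .
qed

lemma mass_nonneg:
  assumes "probability_vector p"
  shows "0 \<le> mass p n N"
  unfolding mass_def p_word_def
  using assms by (intro sum_nonneg prod_list_nonneg) (auto simp: probability_vector_def words_def)

lemma mass_sum: "(\<Sum>N\<in>val ` words n. mass p n N * f N) = (\<Sum>w\<in>words n. p_word p w * f (val w))"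
  unfolding mass_def by (simp add: sum_fibre[of "words n" "p_word p" f val])

lemma sum_words_add:
  "(\<Sum>w\<in>words (n + k). f w) = (\<Sum>u\<in>words n. \<Sum>v\<in>words k. f (u @ v))"
  by (subst sum.reindex_bij_betw[OF words_add, symmetric])
    (simp add: sum.cartesian_product case_prod_beta)

text \<open>A concatenation has value 3^k A + B with independent parts, so the law is a convolution.
  The pairs are written as a fibre of this map, the form in which \<open>sum.group\<close> collects
  them later.\<close>

lemma mass_add:
  "mass p (n + k) N =
     (\<Sum>(A, B)\<in>{z \<in> val ` words n \<times> val ` words k. (case z of (A, B) \<Rightarrow> 3 ^ k * A + B) = N}.
        mass p n A * mass p k B)"
proof -
  \<comment> \<open>The indicator turns the condition on the value into a weight, so that
    \<open>mass_sum\<close> applies to suffix and prefix.\<close>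
  define d :: "nat \<Rightarrow> real" where "d M = (if M = N then 1 else 0)" for M
  have "mass p (n + k) N = (\<Sum>w\<in>words (n + k). p_word p w * d (val w))"
    unfolding mass_def d_def by (simp add: sum.inter_filter if_distrib cong: if_cong)
  also have "\<dots> = (\<Sum>u\<in>words n. p_word p u * (\<Sum>v\<in>words k. p_word p v * d (3 ^ k * val u + val v)))"
    unfolding sum_words_add sum_distrib_left
    by (intro sum.cong) (auto simp: p_word_append val_append words_length mult.assoc)
  also have "\<dots> = (\<Sum>A\<in>val ` words n. mass p n A * (\<Sum>B\<in>val ` words k. mass p k B * d (3 ^ k * A + B)))"
    by (simp add: mass_sum)
  also have "\<dots> = (\<Sum>(A, B)\<in>val ` words n \<times> val ` words k. mass p n A * mass p k B * d (3 ^ k * A + B))"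
    by (simp add: sum_distrib_left sum.cartesian_product mult.assoc)
  also have "\<dots> = (\<Sum>(A, B)\<in>{z \<in> val ` words n \<times> val ` words k. (case z of (A, B) \<Rightarrow> 3 ^ k * A + B) = N}.
        mass p n A * mass p k B)"
    by (subst sum.inter_filter) (auto intro!: sum.cong simp: d_def)
  finally show ?thesis .
qed

text \<open>Subadditivity of the q-th power splits each mass over its pairs; the fibres together
  exhaust the product of the two value sets, where the sum factorises.\<close>

lemma level_sum_submult:
  assumes "probability_vector p" "0 < q" "q < 1"
  shows "level_sum p q (n + k) \<le> level_sum p q n * level_sum p q k"
proof -
  let ?V = "\<lambda>n. val ` words n"
  let ?g = "\<lambda>(A, B). 3 ^ k * A + B"
  have img: "?g ` (?V n \<times> ?V k) \<subseteq> ?V (n + k)"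
  proof clarify
    fix u v assume "u \<in> words n" "v \<in> words k"
    then show "3 ^ k * val u + val v \<in> ?V (n + k)"
      by (intro image_eqI[of _ _ "u @ v"]) (auto simp: val_append words_def)
  qed
  have "level_sum p q (n + k)
      = (\<Sum>N\<in>?V (n + k). (\<Sum>z\<in>{z \<in> ?V n \<times> ?V k. ?g z = N}. mass p n (fst z) * mass p k (snd z)) powr q)"
    by (simp add: level_sum_def mass_add case_prod_beta)
  also have "\<dots> \<le> (\<Sum>N\<in>?V (n + k). \<Sum>z\<in>{z \<in> ?V n \<times> ?V k. ?g z = N}.
      (mass p n (fst z) * mass p k (snd z)) powr q)"
    using assms by (intro sum_mono powr_sum_le mult_nonneg_nonneg mass_nonneg)
  also have "\<dots> = (\<Sum>z\<in>?V n \<times> ?V k. (mass p n (fst z) * mass p k (snd z)) powr q)"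
    by (rule sum.group[OF _ _ img]) auto
  also have "\<dots> = level_sum p q n * level_sum p q k"
    unfolding level_sum_def sum_product sum.cartesian_product
    by (intro sum.cong) (auto simp: powr_mult mass_nonneg[OF assms(1)])
  finally show ?thesis .
qed

section \<open>Self-similar measures\<close>

lemma S_borel [measurable]: "S i \<in> borel_measurable borel"
  unfolding S_def[abs_def] by measurable

lemma S_vimage_borel: "B \<in> sets borel \<Longrightarrow> S i -` B \<in> sets borel"
  using measurable_sets[OF S_borel] by simp

context
  fixes p :: "nat \<Rightarrow> real" and \<nu> :: "real measure"
  assumes pv: "probability_vector p" and ss: "self_similar_measure p \<nu>"
begin

interpretation prob_space \<nu>
  using ss by (simp add: self_similar_measure_def)

lemma sets_nu [measurable_cong, simp]: "sets \<nu> = sets borel"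
  using ss by (simp add: self_similar_measure_def)

lemma measure_UNIV: "measure \<nu> UNIV = 1"
  using prob_space sets_eq_imp_space_eq[OF sets_nu] by simp

lemma measure_words:
  "B \<in> sets borel \<Longrightarrow> measure \<nu> B = (\<Sum>w\<in>words n. p_word p w * measure \<nu> (S_word w -` B))"
proof (induction n arbitrary: B)
  case (Suc n)
  have words1: "words 1 = (\<lambda>i. [i]) ` alphabet"
    by (auto simp: words_def length_Suc_conv)
  have "measure \<nu> B = (\<Sum>i\<in>alphabet. p i * measure \<nu> (S i -` B))"
    using ss Suc.prems by (simp add: self_similar_measure_def)
  also have "\<dots> = (\<Sum>i\<in>alphabet. p i * (\<Sum>w\<in>words n. p_word p w * measure \<nu> (S_word w -` (S i -` B))))"
    using Suc.IH[OF S_vimage_borel[OF Suc.prems]] by simp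
  also have "\<dots> = (\<Sum>w\<in>words (1 + n). p_word p w * measure \<nu> (S_word w -` B))"
    unfolding sum_words_add words1
    by (simp add: sum.reindex inj_on_def sum_distrib_left S_word_Cons vimage_comp p_word_def mult.assoc)
  finally show ?case by simp
qed (simp add: p_word_def)

text \<open>The map involved is the one shared by all words of length k and value N.\<close>

definition pull :: "nat \<Rightarrow> nat \<Rightarrow> real set \<Rightarrow> real set" where
  "pull k N B = {x. (x + 3 * real N) / 3 ^ k \<in> B}"

lemma pull_borel: "B \<in> sets borel \<Longrightarrow> pull k N B \<in> sets borel"
  using measurable_sets[of "\<lambda>x. (x + 3 * real N) / 3 ^ k" borel borel B]
  by (simp add: pull_def vimage_def)

lemma measure_pull:
  assumes "B \<in> sets borel"
  shows "measure \<nu> B = (\<Sum>N\<in>val ` words k. mass p k N * measure \<nu> (pull k N B))"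
proof -
  have "S_word w -` B = pull k (val w) B" if "w \<in> words k" for w
    using that by (auto simp: pull_def S_word_eq words_length)
  then show ?thesis
    using measure_words[OF assms, of k] by (simp add: mass_sum)
qed

lemma sum_mass: "(\<Sum>N\<in>val ` words k. mass p k N) = 1"
  using measure_pull[of UNIV k] by (simp add: pull_def measure_UNIV)

lemma mass_le_1: "mass p k N \<le> 1"
proof (cases "N \<in> val ` words k")
  case True
  then have "mass p k N \<le> (\<Sum>N\<in>val ` words k. mass p k N)"
    by (intro member_le_sum mass_nonneg pv) auto
  then show ?thesis by (simp add: sum_mass)
next
  case False
  then have "mass p k N = 0"
    unfolding mass_def by (intro sum.neutral) auto
  then show ?thesis by simp
qed

text \<open>Masses lie in [0, 1] and add up to 1, and a power below 1 does not decrease them. The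
  bound makes the logarithms nonnegative for Fekete's argument.\<close>

lemma level_sum_ge_1:
  assumes "0 < q" "q < 1"
  shows "1 \<le> level_sum p q k"
proof -
  have "mass p k N \<le> mass p k N powr q" for N
    using powr_mono'[of q 1 "mass p k N"] assms mass_le_1 mass_nonneg[OF pv] by simp
  then show ?thesis
    unfolding level_sum_def sum_mass[of k, symmetric] by (intro sum_mono)
qed

text \<open>\<open>pressure\<close> is defined through \<open>lim\<close>, which is informative only
  once convergence is known; under ln, submultiplicativity becomes subadditivity.\<close>

lemma pressure_limit:
  assumes "0 < q" "q < 1"
  shows "(\<lambda>n. ln (level_sum p q n) / real n) \<longlonglongrightarrow> pressure p q"
proof -
  have "convergent (\<lambda>n. ln (level_sum p q n) / real n)"
  proof (rule subadditive_limit_exists)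
    fix m n
    have ge: "level_sum p q k \<ge> 1" for k
      by (rule level_sum_ge_1[OF assms])
    then show "0 \<le> ln (level_sum p q n)" by simp
    have pos: "level_sum p q k > 0" for k
      using ge[of k] by linarith
    have "ln (level_sum p q (m + n)) \<le> ln (level_sum p q m * level_sum p q n)"
      using pos level_sum_submult[OF pv assms] by (subst ln_le_cancel_iff) auto
    then show "ln (level_sum p q (m + n)) \<le> ln (level_sum p q m) + ln (level_sum p q n)"
      using pos by (simp add: ln_mult_pos)
  qed
  then show ?thesis
    unfolding convergent_LIMSEQ_iff pressure_def level_sum_eq by simp
qed

text \<open>The inverse maps push distant points outwards: |x / 3 + i| > R with 0 \<le> i \<le> 3
  gives |x| > 3 R - 9, and this is at least R + 1 once R \<ge> 5. Mass outside [-5, 5] would thus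
  have to lie beyond every bound.\<close>

lemma measure_support: "measure \<nu> {-5..5} = 1"
proof -
  have step: "measure \<nu> {x. \<bar>x\<bar> > R} \<le> measure \<nu> {x. \<bar>x\<bar> > R + 1}" if "R \<ge> 5" for R
  proof -
    have "measure \<nu> {x. \<bar>x\<bar> > R} = (\<Sum>i\<in>alphabet. p i * measure \<nu> (S i -` {x. \<bar>x\<bar> > R}))"
      using ss by (simp add: self_similar_measure_def)
    also have "\<dots> \<le> (\<Sum>i\<in>alphabet. p i * measure \<nu> {x. \<bar>x\<bar> > R + 1})"
      using pv that unfolding probability_vector_def
      by (intro sum_mono mult_left_mono finite_measure_mono) (auto simp: alphabet_def S_def)
    also have "\<dots> = measure \<nu> {x. \<bar>x\<bar> > R + 1}"
      using pv by (simp add: probability_vector_def flip: sum_distrib_right)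
    finally show ?thesis .
  qed
  have le: "measure \<nu> {x. \<bar>x\<bar> > 5} \<le> measure \<nu> {x. \<bar>x\<bar> > 5 + real n}" for n
  proof (induction n)
    case (Suc n)
    with step[of "5 + real n"] show ?case by (simp add: add_ac)
  qed simp
  have "(\<lambda>n. measure \<nu> {x. \<bar>x\<bar> > 5 + real n}) \<longlonglongrightarrow> measure \<nu> (\<Inter>n. {x. \<bar>x\<bar> > 5 + real n})"
    by (rule finite_Lim_measure_decseq) (auto simp: decseq_def)
  moreover have "(\<Inter>n. {x. \<bar>x\<bar> > 5 + real n}) = {}"
  proof -
    have "\<exists>n. \<not> \<bar>x\<bar> > 5 + real n" for x
    proof -
      obtain n where "\<bar>x\<bar> \<le> real n" using real_arch_simple by blast
      then have "\<not> \<bar>x\<bar> > 5 + real n" by linarith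
      then show ?thesis ..
    qed
    then show ?thesis by blast
  qed
  ultimately have "measure \<nu> {x. \<bar>x\<bar> > 5} \<le> 0"
    using le by (intro LIMSEQ_le_const) auto
  moreover have "measure \<nu> (space \<nu> - {x. \<bar>x\<bar> > 5}) = 1 - measure \<nu> {x. \<bar>x\<bar> > 5}"
    by (rule prob_compl) simp
  moreover have "space \<nu> - {x. \<bar>x\<bar> > 5} = {-5..5}"
    using sets_eq_imp_space_eq[OF sets_nu] by auto
  ultimately show ?thesis
    using measure_nonneg[of \<nu> "{x. \<bar>x\<bar> > 5}"] by simp
qed

lemma measure_eq_0_off_support:
  assumes "B \<in> sets borel" "B \<inter> {-5..5} = {}"
  shows "measure \<nu> B = 0"
proof -
  have "measure \<nu> (B \<union> {-5..5}) = measure \<nu> B + measure \<nu> {-5..5}"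
    using assms by (intro finite_measure_Union) auto
  then show ?thesis
    using prob_le_1[of "B \<union> {-5..5}"] measure_nonneg[of \<nu> B] by (simp add: measure_support)
qed

section \<open>Comparison of dyadic cells with the pieces of level k\<close>

definition cell :: "nat \<Rightarrow> int \<Rightarrow> real set" where
  "cell n j = {real_of_int j / 2 ^ n <.. (real_of_int j + 1) / 2 ^ n}"

definition piece :: "nat \<Rightarrow> nat \<Rightarrow> real set" where
  "piece k N = {(3 * real N - 5) / 3 ^ k .. (3 * real N + 5) / 3 ^ k}"

definition charged :: "nat \<Rightarrow> int set" where
  "charged n = {j. measure \<nu> (cell n j) > 0}"

definition cell_sum :: "real \<Rightarrow> nat \<Rightarrow> real" where
  "cell_sum q n = (\<Sum>j\<in>charged n. measure \<nu> (cell n j) powr q)"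

lemma cell_borel [measurable, simp]: "cell n j \<in> sets borel"
  and piece_borel [measurable, simp]: "piece k N \<in> sets borel"
  by (simp_all add: cell_def piece_def)

lemma cell_meets:
  assumes "cell n j \<inter> {a..b} \<noteq> {}"
  shows "real_of_int j < 2 ^ n * b" "2 ^ n * a \<le> real_of_int j + 1"
proof -
  obtain x where x: "real_of_int j / 2 ^ n < x" "x \<le> (real_of_int j + 1) / 2 ^ n" "a \<le> x" "x \<le> b"
    using assms by (auto simp: cell_def)
  then have "real_of_int j / 2 ^ n < b" "a \<le> (real_of_int j + 1) / 2 ^ n" by linarith+
  then show "real_of_int j < 2 ^ n * b" "2 ^ n * a \<le> real_of_int j + 1"
    by (simp_all add: field_simps)
qed

lemma finite_charged: "finite (charged n)"
proof (rule card_int_le(1))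
  fix j assume "j \<in> charged n"
  then have "cell n j \<inter> {-5..5} \<noteq> {}"
    using measure_eq_0_off_support[of "cell n j"] by (auto simp: charged_def)
  from cell_meets[OF this]
  show "2 ^ n * (-5) - 1 \<le> real_of_int j \<and> real_of_int j \<le> 2 ^ n * 5" by linarith
qed (rule order_refl, simp)

text \<open>Only finitely many cells are charged, so the unordered sum is a finite one and not a
  default value; injectivity allows indexing by integers.\<close>

lemma cell_sum_eq:
  "(\<Sum>\<^sub>\<infinity>C\<in>{C \<in> dyadic_cells n. measure \<nu> C > 0}. measure \<nu> C powr q) = cell_sum q n"
proof -
  have eq: "{C \<in> dyadic_cells n. measure \<nu> C > 0} = cell n ` charged n"
    by (auto simp: dyadic_cells_def charged_def cell_def)
  have "inj (cell n)"
  proof (rule injI)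
    fix i j assume "cell n i = cell n j"
    then show "i = j"
      by (simp add: cell_def Ioc_inj divide_le_cancel)
  qed
  then have "inj_on (cell n) (charged n)" by (rule inj_on_subset) simp
  then show ?thesis
    unfolding eq cell_sum_def by (simp add: finite_charged sum.reindex)
qed

lemma cell_cover: "\<exists>j. x \<in> cell n j"
proof
  \<comment> \<open>Cells are open on the left and closed on the right, hence the ceiling minus one
    and not the floor.\<close>
  show "x \<in> cell n (\<lceil>x * 2 ^ n\<rceil> - 1)"
    by (simp add: cell_def pos_divide_less_eq pos_le_divide_eq) linarith
qed

lemma cells_meeting_piece:
  assumes "3 ^ k \<le> (2::nat) ^ n" "(2::nat) ^ n < 3 ^ (k + 1)"
  shows "finite {j. cell n j \<inter> piece k N \<noteq> {}}" "real (card {j. cell n j \<inter> piece k N \<noteq> {}}) \<le> 32"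
proof -
  define t where "t = (2::real) ^ n / 3 ^ k"
  have "real (2 ^ n) < real (3 ^ (k + 1))" 
    using assms(2) by (simp only: of_nat_less_iff)
  then have t: "t < 3" by (simp add: t_def field_simps)
  have b: "t * (3 * real N - 5) - 1 \<le> real_of_int j \<and> real_of_int j \<le> t * (3 * real N + 5)"
    if "j \<in> {j. cell n j \<inter> piece k N \<noteq> {}}" for j
    using cell_meets[of n j "(3 * real N - 5) / 3 ^ k" "(3 * real N + 5) / 3 ^ k"] that
    by (simp add: piece_def t_def)
  \<comment> \<open>The range for j has length 10 t + 1 with t < 3, which gives the constant 32 = 31
    + 1.\<close>
  have w: "t * (3 * real N + 5) - (t * (3 * real N - 5) - 1) \<le> 31"
    using t by (simp add: algebra_simps)
  show "finite {j. cell n j \<inter> piece k N \<noteq> {}}"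
    by (rule card_int_le(1)[where A = "{j. cell n j \<inter> piece k N \<noteq> {}}", OF b w]) auto
  show "real (card {j. cell n j \<inter> piece k N \<noteq> {}}) \<le> 32"
    using card_int_le(2)[where A = "{j. cell n j \<inter> piece k N \<noteq> {}}", OF b w] by simp
qed

lemma pieces_meeting_cell:
  assumes "3 ^ k \<le> (2::nat) ^ n"
  shows "finite {N. cell n j \<inter> piece k N \<noteq> {}}" "real (card {N. cell n j \<inter> piece k N \<noteq> {}}) \<le> 5"
proof -
  define t where "t = (3::real) ^ k / 2 ^ n"
  have "real (3 ^ k) \<le> real (2 ^ n)" using assms by (rule of_nat_mono)
  then have t: "t \<le> 1" by (simp add: t_def)
  let ?A = "{N. cell n j \<inter> piece k N \<noteq> {}}"
  have b: "(t * real_of_int j - 5) / 3 \<le> real_of_int i \<and> real_of_int i \<le> (t * (real_of_int j + 1) + 5) / 3"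
    if i: "i \<in> int ` ?A" for i
  proof -
    obtain N where N: "i = int N" "cell n j \<inter> piece k N \<noteq> {}" using i by auto
    have "real_of_int j < 2 ^ n * ((3 * real N + 5) / 3 ^ k)"
        "2 ^ n * ((3 * real N - 5) / 3 ^ k) \<le> real_of_int j + 1"
      using cell_meets[of n j "(3 * real N - 5) / 3 ^ k" "(3 * real N + 5) / 3 ^ k"] N(2)
      by (simp_all add: piece_def)
    then have "t * real_of_int j \<le> 3 * real N + 5" "3 * real N - 5 \<le> t * (real_of_int j + 1)"
      by (simp_all add: t_def field_simps)
    then show ?thesis using N(1) by simp
  qed
  \<comment> \<open>The range for N has length (t + 10) / 3 with t \<le> 1, hence below 4, and so
    holds at most 5 integers.\<close>
  have w: "(t * (real_of_int j + 1) + 5) / 3 - (t * real_of_int j - 5) / 3 \<le> 4"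
    using t by (simp add: field_simps)
  show "finite ?A"
    using card_int_le(1)[where A = "int ` ?A", OF b w] by (simp add: finite_image_iff)
  show "real (card ?A) \<le> 5"
    using card_int_le(2)[where A = "int ` ?A", OF b w] by (simp add: card_image)
qed

text \<open>Decompose the measure of the cell at level k and use subadditivity. If the piece of N
  misses the cell, the pulled-back cell misses [-5, 5] and its term is 0 powr q = 0; otherwise the
  measure factor is at most 1.\<close>

lemma cell_measure_le:
  assumes "0 < q" "q < 1"
  shows "measure \<nu> (cell n j) powr q
    \<le> (\<Sum>N\<in>{N\<in>val ` words k. cell n j \<inter> piece k N \<noteq> {}}. mass p k N powr q)"
proof -
  have "measure \<nu> (cell n j) powr q
      \<le> (\<Sum>N\<in>val ` words k. (mass p k N * measure \<nu> (pull k N (cell n j))) powr q)"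
    using assms pv
    by (subst measure_pull[OF cell_borel, of n j k]) (intro powr_sum_le mult_nonneg_nonneg mass_nonneg, auto)
  also have "\<dots> \<le> (\<Sum>N\<in>val ` words k. if cell n j \<inter> piece k N \<noteq> {} then mass p k N powr q else 0)"
  proof (rule sum_mono)
    fix N
    show "(mass p k N * measure \<nu> (pull k N (cell n j))) powr q
        \<le> (if cell n j \<inter> piece k N \<noteq> {} then mass p k N powr q else 0)"
    proof (cases "cell n j \<inter> piece k N \<noteq> {}")
      case True
      have "(mass p k N * measure \<nu> (pull k N (cell n j))) powr q \<le> mass p k N powr q"
        using assms mass_nonneg[OF pv, of k N] by (intro powr_mono2 mult_left_le) auto
      with True show ?thesis by simp
    next
      case False
      have "pull k N (cell n j) \<inter> {-5..5} = {}"
      proof (rule ccontr)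
        assume "pull k N (cell n j) \<inter> {-5..5} \<noteq> {}"
        then obtain x where "(x + 3 * real N) / 3 ^ k \<in> cell n j" "-5 \<le> x" "x \<le> 5"
          by (auto simp: pull_def)
        then have "(x + 3 * real N) / 3 ^ k \<in> cell n j \<inter> piece k N"
          by (auto simp: piece_def intro!: divide_right_mono)
        with False show False by blast
      qed
      then have "measure \<nu> (pull k N (cell n j)) = 0"
        by (intro measure_eq_0_off_support pull_borel) auto
      with False show ?thesis by simp
    qed
  qed
  finally show ?thesis by (simp add: sum.inter_filter)
qed

text \<open>The piece of N, pulled back by its own map, contains [-5, 5], so the whole mass at N
  counts towards the measure of the piece. Covering the piece by cells and subadditivity do the
  rest.\<close>

lemma mass_le:
  assumes "0 < q" "q < 1" "N \<in> val ` words k" and fin: "finite {j. cell n j \<inter> piece k N \<noteq> {}}"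
  shows "mass p k N powr q
    \<le> (\<Sum>j\<in>{j\<in>charged n. cell n j \<inter> piece k N \<noteq> {}}. measure \<nu> (cell n j) powr q)"
proof -
  let ?J = "{j. cell n j \<inter> piece k N \<noteq> {}}"
  have "{-5..5} \<subseteq> pull k N (piece k N)"
    by (auto simp: pull_def piece_def intro!: divide_right_mono)
  then have "measure \<nu> {-5..5} \<le> measure \<nu> (pull k N (piece k N))"
    by (intro finite_measure_mono) (auto intro: pull_borel)
  then have "mass p k N \<le> mass p k N * measure \<nu> (pull k N (piece k N))"
    using mass_nonneg[OF pv, of k N] mult_left_mono[of 1 _ "mass p k N"] by (simp add: measure_support)
  also have "\<dots> \<le> measure \<nu> (piece k N)"
    using assms(3) by (subst measure_pull[OF piece_borel, of k N k])
      (auto intro!: member_le_sum mult_nonneg_nonneg mass_nonneg[OF pv])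
  also have "\<dots> \<le> measure \<nu> (\<Union>j\<in>?J. cell n j)"
    using cell_cover fin by (intro finite_measure_mono) (blast, auto)
  also have "\<dots> \<le> (\<Sum>j\<in>?J. measure \<nu> (cell n j))"
    using fin by (intro finite_measure_subadditive_finite) auto
  \<comment> \<open>Cells of measure zero are dropped because \<open>cell_sum\<close> runs over
    charged cells only.\<close>
  also have "\<dots> = (\<Sum>j\<in>{j\<in>charged n. cell n j \<inter> piece k N \<noteq> {}}. measure \<nu> (cell n j))"
    using fin by (intro sum.mono_neutral_right) (auto simp: charged_def zero_less_measure_iff)
  finally have "mass p k N powr q \<le> \<dots> powr q"
    using assms by (intro powr_mono2 mass_nonneg pv) auto
  also have "\<dots> \<le> (\<Sum>j\<in>{j\<in>charged n. cell n j \<inter> piece k N \<noteq> {}}. measure \<nu> (cell n j) powr q)"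
    using assms by (intro powr_sum_le) auto
  finally show ?thesis .
qed

text \<open>Double counting of the meeting pairs of cells and pieces: after exchanging the sums,
  each N occurs for at most 32 cells.\<close>

lemma cell_sum_le:
  assumes "0 < q" "q < 1" and k: "3 ^ k \<le> (2::nat) ^ n" "(2::nat) ^ n < 3 ^ (k + 1)"
  shows "cell_sum q n \<le> 32 * level_sum p q k"
proof -
  have "cell_sum q n \<le> (\<Sum>j\<in>charged n. \<Sum>N\<in>{N\<in>val ` words k. cell n j \<inter> piece k N \<noteq> {}}. mass p k N powr q)"
    unfolding cell_sum_def by (intro sum_mono cell_measure_le assms)
  also have "\<dots> = (\<Sum>N\<in>val ` words k. \<Sum>j\<in>{j\<in>charged n. cell n j \<inter> piece k N \<noteq> {}}. mass p k N powr q)"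
    by (rule sum.swap_restrict) (auto simp: finite_charged)
  also have "\<dots> \<le> (\<Sum>N\<in>val ` words k. 32 * mass p k N powr q)"
  proof (rule sum_mono)
    fix N
    have "card {j\<in>charged n. cell n j \<inter> piece k N \<noteq> {}} \<le> card {j. cell n j \<inter> piece k N \<noteq> {}}"
      using cells_meeting_piece(1)[OF k] by (intro card_mono) auto
    then have "real (card {j\<in>charged n. cell n j \<inter> piece k N \<noteq> {}}) \<le> 32"
      using cells_meeting_piece(2)[OF k, of N] by linarith
    then show "(\<Sum>j\<in>{j\<in>charged n. cell n j \<inter> piece k N \<noteq> {}}. mass p k N powr q) \<le> 32 * mass p k N powr q"
      by (simp add: mult_right_mono)
  qed
  finally show ?thesis by (simp add: level_sum_def sum_distrib_left)
qed

text \<open>The same pairs counted the other way, with at most 5 pieces for each cell.\<close>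

lemma level_sum_le:
  assumes "0 < q" "q < 1" and k: "3 ^ k \<le> (2::nat) ^ n" "(2::nat) ^ n < 3 ^ (k + 1)"
  shows "level_sum p q k \<le> 5 * cell_sum q n"
proof -
  have "level_sum p q k
      \<le> (\<Sum>N\<in>val ` words k. \<Sum>j\<in>{j\<in>charged n. cell n j \<inter> piece k N \<noteq> {}}. measure \<nu> (cell n j) powr q)"
    unfolding level_sum_def by (intro sum_mono mass_le assms cells_meeting_piece(1)[OF k])
  also have "\<dots> = (\<Sum>j\<in>charged n. \<Sum>N\<in>{N\<in>val ` words k. cell n j \<inter> piece k N \<noteq> {}}. measure \<nu> (cell n j) powr q)"
    by (rule sum.swap_restrict) (auto simp: finite_charged)
  also have "\<dots> \<le> (\<Sum>j\<in>charged n. 5 * measure \<nu> (cell n j) powr q)"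
  proof (rule sum_mono)
    fix j
    have "card {N\<in>val ` words k. cell n j \<inter> piece k N \<noteq> {}} \<le> card {N. cell n j \<inter> piece k N \<noteq> {}}"
      using pieces_meeting_cell(1)[OF k(1)] by (intro card_mono) auto
    then have "real (card {N\<in>val ` words k. cell n j \<inter> piece k N \<noteq> {}}) \<le> 5"
      using pieces_meeting_cell(2)[OF k(1), of j] by linarith
    then show "(\<Sum>N\<in>{N\<in>val ` words k. cell n j \<inter> piece k N \<noteq> {}}. measure \<nu> (cell n j) powr q)
        \<le> 5 * measure \<nu> (cell n j) powr q"
      by (simp add: mult_right_mono)
  qed
  finally show ?thesis by (simp add: cell_sum_def sum_distrib_left)
qed

end

section \<open>Passage to the limit along the dyadic scales\<close>

theorem corollary3p3:
  fixes p :: "nat \<Rightarrow> real" and \<nu> :: "real measure" and q :: real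
  assumes "probability_vector p"
    and "p 0 > 0" and "p 1 > 0" and "p 3 > 0"
    and "self_similar_measure p \<nu>"
    and "0 < q" and "q < 1"
  shows "Lq_spectrum \<nu> q = ereal (pressure p q / ln 3)"
proof -
  note meas = assms(1,5) and q = assms(6,7)
  define a where "a = level_sum p q"
  define b where "b = cell_sum \<nu> q"
  \<comment> \<open>\<open>k n\<close> will be the integer part of the base-3 logarithm of 2^n, so
    that cells of level n and pieces of level \<open>k n\<close> have comparable length.\<close>
  have "\<exists>k. 3 ^ k \<le> (2::nat) ^ n \<and> (2::nat) ^ n < 3 ^ (k + 1)" for n
    by (rule ex_power_ivl1) auto
  then obtain k where k: "3 ^ k n \<le> (2::nat) ^ n" "(2::nat) ^ n < 3 ^ (k n + 1)" for n
    by metis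
  have a1: "a n \<ge> 1" for n
    unfolding a_def by (rule level_sum_ge_1[OF meas q])
  have ab: "a (k n) \<le> 5 * b n" and ba: "b n \<le> 32 * a (k n)" for n
    unfolding a_def b_def using level_sum_le[OF meas q k] cell_sum_le[OF meas q k] by blast+
  have kn: "real (k n) * ln 3 \<le> real n * ln 2" "real n * ln 2 \<le> (real (k n) + 1) * ln 3" for n
  proof -
    have "real (3 ^ k n) \<le> real (2 ^ n)" "real (2 ^ n) \<le> real (3 ^ (k n + 1))"
      using k[of n] by (intro of_nat_mono; simp)+
    then have "ln ((3::real) ^ k n) \<le> ln (2 ^ n)" "ln ((2::real) ^ n) \<le> ln (3 ^ (k n + 1))"
      by (subst ln_le_cancel_iff; simp)+
    then show "real (k n) * ln 3 \<le> real n * ln 2" "real n * ln 2 \<le> (real (k n) + 1) * ln 3"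
      by (simp_all add: ln_realpow add.commute del: power_Suc power_Suc2)
  qed
  have ratio: "(\<lambda>n. real (k n) / real n) \<longlonglongrightarrow> ln 2 / ln 3"
  proof (rule tendsto_sandwich)
    show "\<forall>\<^sub>F n in sequentially. ln 2 / ln 3 - 1 / real n \<le> real (k n) / real n"
      using eventually_gt_at_top[of 0]
    proof eventually_elim
      case (elim n)
      with kn(2)[of n] have "ln 2 / ln 3 \<le> (real (k n) + 1) / real n"
        by (simp add: pos_divide_le_eq pos_le_divide_eq mult.commute)
      then show ?case by (simp add: add_divide_distrib)
    qed
    show "\<forall>\<^sub>F n in sequentially. real (k n) / real n \<le> ln 2 / ln 3"
      using eventually_gt_at_top[of 0]
    proof eventually_elim
      case (elim n)
      with kn(1)[of n] show ?case
        by (simp add: pos_divide_le_eq pos_le_divide_eq mult.commute)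
    qed
    show "(\<lambda>n. ln 2 / ln 3 - 1 / real n) \<longlonglongrightarrow> ln 2 / ln 3"
      using tendsto_diff[OF tendsto_const lim_1_over_n, of "ln 2 / ln 3 :: real"] by simp
  qed simp
  have k_top: "filterlim k at_top sequentially"
    unfolding filterlim_at_top eventually_sequentially
  proof (intro allI exI impI)
    \<comment> \<open>The threshold 2 Z works because 3^Z \<le> 4^Z \<le> 2^n < 3^(k n + 1).\<close>
    fix Z n :: nat assume "2 * Z \<le> n"
    then have "(2::nat) ^ (2 * Z) \<le> 2 ^ n" by (intro power_increasing) auto
    moreover have "(3::nat) ^ Z \<le> 2 ^ (2 * Z)"
      unfolding power_mult by (intro power_mono) auto
    ultimately have "(3::nat) ^ Z < 3 ^ (k n + 1)" using k(2)[of n] by linarith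
    then have "Z < k n + 1" by (rule power_less_imp_less_exp[rotated]) simp
    then show "Z \<le> k n" by simp
  qed
  have "(\<lambda>n. ln (a (k n)) / real (k n) * (real (k n) / real n)) \<longlonglongrightarrow> pressure p q * (ln 2 / ln 3)"
    unfolding a_def
    by (intro tendsto_mult ratio filterlim_compose[OF pressure_limit[OF meas q] k_top])
  \<comment> \<open>The factor \<open>real (k n)\<close> cancels once k n \<ge> 1; at k n = 0 the
    division by zero would make the left side 0.\<close>
  moreover have "\<forall>\<^sub>F n in sequentially. ln (a (k n)) / real (k n) * (real (k n) / real n) = ln (a (k n)) / real n"
    using filterlim_at_top[THEN iffD1, OF k_top, rule_format, of 1]
    by eventually_elim simp
  ultimately have lim: "(\<lambda>n. ln (a (k n)) / real n) \<longlonglongrightarrow> pressure p q * (ln 2 / ln 3)"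
    by (rule Lim_transform_eventually)
  \<comment> \<open>The two sums agree up to bounded factors, so their logarithms differ by a
    bounded amount, which the division by n removes.\<close>
  have "(\<lambda>n. (ln (b n) - ln (a (k n))) / real n) \<longlonglongrightarrow> 0"
  proof (rule Lim_null_comparison)
    show "\<forall>\<^sub>F n in sequentially. norm ((ln (b n) - ln (a (k n))) / real n) \<le> ln 32 / real n"
    proof (rule always_eventually, rule allI)
      fix n
      have apos: "a (k n) > 0" using a1[of "k n"] by linarith
      have bpos: "b n > 0" using apos ab[of n] by linarith
      \<comment> \<open>The constant 5 of \<open>ab\<close> is weakened to 32 to have one bound for
        both signs of the difference.\<close>
      have "ln (b n) \<le> ln (32 * a (k n))" "ln (a (k n)) \<le> ln (32 * b n)"
        using apos bpos ab[of n] ba[of n] by (subst ln_le_cancel_iff; simp)+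
      then have "\<bar>ln (b n) - ln (a (k n))\<bar> \<le> ln 32"
        using apos bpos by (simp add: ln_mult_pos abs_le_iff)
      then show "norm ((ln (b n) - ln (a (k n))) / real n) \<le> ln 32 / real n"
        by (simp add: abs_divide divide_right_mono)
    qed
    show "(\<lambda>n. ln 32 / real n) \<longlonglongrightarrow> 0"
      by (rule lim_const_over_n)
  qed
  from tendsto_add[OF this lim]
  have "(\<lambda>n. ln (b n) / real n) \<longlonglongrightarrow> pressure p q * (ln 2 / ln 3)"
    by (simp add: diff_divide_distrib)
  \<comment> \<open>As ln (2 ^ n) is n ln 2, the numerator of the scale ratio ln 2 / ln 3
    cancels.\<close>
  from tendsto_divide[OF this tendsto_const, of "ln 2"]
  have "(\<lambda>n. ln (b n) / ln (2 ^ n)) \<longlonglongrightarrow> pressure p q / ln 3"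
    by (simp add: ln_realpow)
  then have "(\<lambda>n. ereal (ln (b n) / ln (2 ^ n))) \<longlonglongrightarrow> ereal (pressure p q / ln 3)"
    by simp
  then show ?thesis
    unfolding Lq_spectrum_def cell_sum_eq[OF meas] b_def[symmetric]
    by (intro lim_imp_Limsup) simp_all
qed

end
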